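(* The censor $\tilde b(\mu,\sigma)$, for $\mu>0$, $\sigma>0$, is decreasing in the drift $\mu$ (for fixed $\sigma$) and is increasing in the standard deviation $\sigma$ (for fixed $\mu$).
   Context: For $\mu,\sigma>0$ let $b$ be a log-normal random variable such that $\ln b$ is normal with mean $\mu-\tfrac12\sigma^2$ and variance $\sigma^2$ (so $E[b]=e^\mu$). The censor $\tilde b=\tilde b(\mu,\sigma)$ is the scalar solving $E[\min(b,\tilde b)]=1$. Equivalently, it solves $$1=e^{\mu}\Phi(W-\sigma)+\tilde b\,\Phi(-W),\qquad W=\frac{\ln\tilde b-(\mu-\frac12\sigma^2)}{\sigma},$$ where $\Phi$ is the standard normal cumulative distribution function. *)

theory Defs
  imports "HOL-Probability.Probability"
begin

text \<open>
  Law of a random variable \<open>b\<close> such that \<open>ln b\<close> is normal with mean \<open>\<mu> - \<sigma>\<^sup>2 / 2\<close> and variance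
  \<open>\<sigma>\<^sup>2\<close>. The second argument of \<open>normal_density\<close> is the standard deviation.
\<close>

definition lognormal :: "real \<Rightarrow> real \<Rightarrow> real measure" where
  "lognormal \<mu> \<sigma> = distr (density lborel (normal_density (\<mu> - \<sigma>\<^sup>2 / 2) \<sigma>)) borel exp"

text \<open>
  The scalar \<open>c\<close> with \<open>E[min b c] = 1\<close>. For \<open>\<mu> > 0\<close> and \<open>\<sigma> > 0\<close> there is exactly one such real
  number, and it is greater than 1: \<open>E[min b c]\<close> is at most \<open>c\<close>, and on \<open>c > 0\<close> it is
  continuous and strictly increasing with limit \<open>E[b] = exp \<mu>\<close>.
\<close>

definition censor :: "real \<Rightarrow> real \<Rightarrow> real" where
  "censor \<mu> \<sigma> = (THE c. (\<integral>b. min b c \<partial>lognormal \<mu> \<sigma>) = 1)"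

end

theory Submission
  imports Defs
begin

text \<open>
  Every log-normal variable in question can be written as
  \<open>b\<^sub>\<mu>\<^sub>\<sigma>(z) = exp (\<mu> - \<sigma>\<^sup>2/2 + \<sigma> z)\<close> with one and the same standard normal \<open>z\<close>. This coupling
  turns the comparison of two censors into pointwise comparisons in \<open>z\<close>.

  Put \<open>G \<mu> \<sigma> c = E[min b\<^sub>\<mu>\<^sub>\<sigma> c]\<close>. It is continuous and strictly increasing in \<open>c\<close>, at most 1
  at \<open>c = 1\<close>, and tends to \<open>E[b] = exp \<mu> > 1\<close>; so the censor is the unique root of
  \<open>G \<mu> \<sigma> c = 1\<close>, and it moves against \<open>G\<close>: a parameter change that raises \<open>G\<close> at the old
  censor lowers the censor. It remains to see how \<open>G\<close> depends on the parameters for \<open>c > 0\<close>.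

  In \<open>\<mu>\<close> it increases, because \<open>b\<close> does so pointwise (\<open>capped_mean_drift_less\<close>).

  In \<open>\<sigma>\<close> it decreases (\<open>capped_mean_volatility_less\<close>), which expresses that more dispersion at
  an unchanged mean \<open>E[b] = exp \<mu>\<close> lowers the expectation of a concave payoff. Here is the reason. For
  \<open>\<sigma> < \<sigma>'\<close> the curves \<open>b\<^sub>\<mu>\<^sub>\<sigma>\<close> and \<open>b\<^sub>\<mu>\<^sub>\<sigma>\<^sub>'\<close> cross exactly once, at \<open>z\<^sub>0 = (\<sigma> + \<sigma>')/2\<close> and
  height \<open>y\<^sub>0 = exp (\<mu> + \<sigma> \<sigma>'/2)\<close>, and the more dispersed one is lower before \<open>z\<^sub>0\<close> and higher
  after it. A cap \<open>c \<le> y\<^sub>0\<close> hides everything after the crossing, so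
  \<open>min b\<^sub>\<mu>\<^sub>\<sigma>\<^sub>' c \<le> min b\<^sub>\<mu>\<^sub>\<sigma> c\<close> everywhere. For a cap \<open>c > y\<^sub>0\<close> it is the excess
  \<open>b - min b c\<close> that vanishes before the crossing, so it is at least as large for \<open>\<sigma>'\<close> everywhere;
  as the means of \<open>b\<close> agree, the capped mean is smaller for \<open>\<sigma>'\<close>. The inequalities between
  expectations are strict, because the pointwise ones are strict on some interval of values of \<open>z\<close>.
\<close>

section \<open>Log-normal variables driven by one standard normal\<close>

abbreviation std_normal :: "real measure" where
  "std_normal \<equiv> density lborel (\<lambda>z. ennreal (std_normal_density z))"

definition lognormal_var :: "real \<Rightarrow> real \<Rightarrow> real \<Rightarrow> real" where
  "lognormal_var \<mu> \<sigma> z = exp (\<mu> - \<sigma>\<^sup>2 / 2 + \<sigma> * z)"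

definition capped_mean :: "real \<Rightarrow> real \<Rightarrow> real \<Rightarrow> real" where
  "capped_mean \<mu> \<sigma> c = (\<integral>z. min (lognormal_var \<mu> \<sigma> z) c \<partial>std_normal)"

interpretation std_normal: prob_space std_normal
  by (rule prob_space_normal_density) simp

lemma lognormal_var_measurable [measurable]: "lognormal_var \<mu> \<sigma> \<in> borel_measurable borel"
  unfolding lognormal_var_def[abs_def] by measurable

lemma lognormal_var_pos: "0 < lognormal_var \<mu> \<sigma> z"
  by (simp add: lognormal_var_def)

lemma integral_lognormal:
  fixes f :: "real \<Rightarrow> real"
  assumes "0 < \<sigma>" and [measurable]: "f \<in> borel_measurable borel"
  shows "(\<integral>b. f b \<partial>lognormal \<mu> \<sigma>) = (\<integral>z. f (lognormal_var \<mu> \<sigma> z) \<partial>std_normal)"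
proof -
  let ?m = "\<mu> - \<sigma>\<^sup>2 / 2"
  have "(\<integral>b. f b \<partial>lognormal \<mu> \<sigma>) = (\<integral>x. normal_density ?m \<sigma> x * f (exp x) \<partial>lborel)"
    unfolding lognormal_def by (simp add: integral_distr integral_density)
  also have "\<dots> = \<bar>\<sigma>\<bar> *\<^sub>R (\<integral>z. normal_density ?m \<sigma> (?m + \<sigma> * z) * f (exp (?m + \<sigma> * z)) \<partial>lborel)"
    using assms by (intro lborel_integral_real_affine) simp
  also have "\<dots> = (\<integral>z. std_normal_density z * f (lognormal_var \<mu> \<sigma> z) \<partial>lborel)"
  proof -
    have "\<sigma> * normal_density ?m \<sigma> (?m + \<sigma> * z) = std_normal_density z" for z
      using assms(1) by (simp add: normal_density_def real_sqrt_mult power_mult_distrib)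
    then have "\<sigma> * (normal_density ?m \<sigma> (?m + \<sigma> * z) * f (exp (?m + \<sigma> * z)))
        = std_normal_density z * f (lognormal_var \<mu> \<sigma> z)" for z
      unfolding lognormal_var_def by (metis mult.assoc)
    moreover have "\<bar>\<sigma>\<bar> = \<sigma>"
      using assms(1) by simp
    ultimately show ?thesis
      by (simp only: real_scaleR_def integral_mult_right_zero[symmetric])
  qed
  also have "\<dots> = (\<integral>z. f (lognormal_var \<mu> \<sigma> z) \<partial>std_normal)"
    by (simp add: integral_density)
  finally show ?thesis .
qed

corollary censor_eq_root_capped_mean:
  assumes "0 < \<sigma>"
  shows "censor \<mu> \<sigma> = (THE c. capped_mean \<mu> \<sigma> c = 1)"
  using assms by (simp add: censor_def capped_mean_def integral_lognormal)

text \<open>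
  Completing the square, \<open>exp (- \<sigma>\<^sup>2/2 + \<sigma> z)\<close> times the standard normal density is the normal
  density shifted by \<open>\<sigma>\<close>, which has total mass 1. So the mean does not depend on \<open>\<sigma>\<close>.
\<close>

lemma lognormal_var_times_density:
  "std_normal_density z * lognormal_var \<mu> \<sigma> z = exp \<mu> * normal_density \<sigma> 1 z"
proof -
  have "- (z\<^sup>2 / 2) + (\<mu> - \<sigma>\<^sup>2 / 2 + \<sigma> * z) = \<mu> + - ((z - \<sigma>)\<^sup>2 / 2)"
    by (simp add: power2_eq_square field_simps)
  then have "exp (- (z\<^sup>2 / 2)) * exp (\<mu> - \<sigma>\<^sup>2 / 2 + \<sigma> * z) = exp \<mu> * exp (- ((z - \<sigma>)\<^sup>2 / 2))"
    by (simp only: exp_add[symmetric])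
  then show ?thesis
    by (simp add: normal_density_def lognormal_var_def)
qed

lemma integrable_lognormal_var: "integrable std_normal (lognormal_var \<mu> \<sigma>)"
  by (simp add: integrable_density lognormal_var_times_density)

lemma mean_lognormal_var: "(\<integral>z. lognormal_var \<mu> \<sigma> z \<partial>std_normal) = exp \<mu>"
  by (simp add: integral_density lognormal_var_times_density integral_normal_density)

lemma integrable_capped: "integrable std_normal (\<lambda>z. min (lognormal_var \<mu> \<sigma> z) c)"
  by (intro integrable_min integrable_lognormal_var) simp

section \<open>Strict comparison of expectations\<close>

text \<open>
  The source of all strict inequalities below: every nonempty interval has positive probability,
  as the normal density vanishes nowhere.
\<close>

lemma std_normal_integral_strict_mono:
  fixes f g :: "real \<Rightarrow> real"
  assumes "integrable std_normal f" "integrable std_normal g"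
    and le: "\<And>z. f z \<le> g z"
    and "a < b" and less: "\<And>z. a < z \<Longrightarrow> z < b \<Longrightarrow> f z < g z"
  shows "(\<integral>z. f z \<partial>std_normal) < (\<integral>z. g z \<partial>std_normal)"
proof (rule std_normal.integral_less_AE[OF assms(1,2), where A = "{a<..<b}"])
  show "emeasure std_normal {a<..<b} \<noteq> 0"
  proof
    assume "emeasure std_normal {a<..<b} = 0"
    then have "{a<..<b} \<in> null_sets std_normal" by (simp add: null_sets_def)
    then have "AE z in lborel. z \<in> {a<..<b} \<longrightarrow> std_normal_density z = 0"
      by (subst (asm) null_sets_density_iff) auto
    then have "AE z in lborel. z \<notin> {a<..<b}"
      by eventually_elim (use normal_density_pos[of 1 0] in \<open>force simp: less_le\<close>)
    then have "emeasure lborel {a<..<b} = 0"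
      by (subst (asm) AE_iff_null_sets[symmetric]) auto
    then show False using \<open>a < b\<close> by simp
  qed
qed (use le less in \<open>auto intro!: AE_I2 simp: less_imp_neq\<close>)

lemma lognormal_var_less_iff:
  assumes "0 < \<sigma>" "0 < k"
  shows "lognormal_var \<mu> \<sigma> z < k \<longleftrightarrow> z < (ln k - \<mu> + \<sigma>\<^sup>2 / 2) / \<sigma>"
    and "k < lognormal_var \<mu> \<sigma> z \<longleftrightarrow> (ln k - \<mu> + \<sigma>\<^sup>2 / 2) / \<sigma> < z"
proof -
  have "lognormal_var \<mu> \<sigma> z < k \<longleftrightarrow> \<mu> - \<sigma>\<^sup>2 / 2 + \<sigma> * z < ln k"
    unfolding lognormal_var_def using assms by (metis exp_less_cancel_iff exp_ln)
  then show "lognormal_var \<mu> \<sigma> z < k \<longleftrightarrow> z < (ln k - \<mu> + \<sigma>\<^sup>2 / 2) / \<sigma>"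
    using assms by (auto simp: pos_less_divide_eq algebra_simps)
  have "k < lognormal_var \<mu> \<sigma> z \<longleftrightarrow> ln k < \<mu> - \<sigma>\<^sup>2 / 2 + \<sigma> * z"
    unfolding lognormal_var_def using assms by (metis exp_less_cancel_iff exp_ln)
  then show "k < lognormal_var \<mu> \<sigma> z \<longleftrightarrow> (ln k - \<mu> + \<sigma>\<^sup>2 / 2) / \<sigma> < z"
    using assms by (auto simp: pos_divide_less_eq algebra_simps)
qed

text \<open>
  A log-normal variable takes arbitrarily small and arbitrarily large values, also under a
  constraint on \<open>z\<close> that leaves room on the relevant side. This provides the intervals on which the
  inequalities are strict.
\<close>

lemma lognormal_var_below:
  assumes "0 < \<sigma>" "0 < k"
  obtains a b where "a < b" "b \<le> t" "\<And>z. z < b \<Longrightarrow> lognormal_var \<mu> \<sigma> z < k"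
proof
  let ?b = "min t ((ln k - \<mu> + \<sigma>\<^sup>2 / 2) / \<sigma>)"
  show "?b - 1 < ?b" by linarith
  show "?b \<le> t" by simp
  show "lognormal_var \<mu> \<sigma> z < k" if "z < ?b" for z
    using that lognormal_var_less_iff(1)[OF assms] by simp
qed

lemma lognormal_var_above:
  assumes "0 < \<sigma>"
  obtains a b where "a < b" "t \<le> a" "\<And>z. a < z \<Longrightarrow> k < lognormal_var \<mu> \<sigma> z"
proof
  let ?k = "max k 1"
  let ?a = "max t ((ln ?k - \<mu> + \<sigma>\<^sup>2 / 2) / \<sigma>)"
  show "?a < ?a + 1" "t \<le> ?a" by simp_all
  show "k < lognormal_var \<mu> \<sigma> z" if "?a < z" for z
    using that lognormal_var_less_iff(2)[OF assms, of ?k \<mu> z] by simp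
qed

section \<open>Monotonicity of the capped mean\<close>

lemma capped_mean_cap_strict_mono:
  assumes "0 < \<sigma>"
  shows "strict_mono (capped_mean \<mu> \<sigma>)"
proof (rule strict_monoI)
  fix c d :: real assume "c < d"
  obtain a b where ab: "a < b" and above: "\<And>z. a < z \<Longrightarrow> c < lognormal_var \<mu> \<sigma> z"
    using lognormal_var_above[OF assms] by metis
  show "capped_mean \<mu> \<sigma> c < capped_mean \<mu> \<sigma> d"
    unfolding capped_mean_def
  proof (rule std_normal_integral_strict_mono[OF integrable_capped integrable_capped _ ab])
    show "min (lognormal_var \<mu> \<sigma> z) c < min (lognormal_var \<mu> \<sigma> z) d" if "a < z" for z
      using above[OF that] \<open>c < d\<close> by simp
  qed (use \<open>c < d\<close> in simp)
qed

lemma capped_mean_drift_less: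
  assumes "0 < \<sigma>" "0 < c" "\<mu> < \<mu>'"
  shows "capped_mean \<mu> \<sigma> c < capped_mean \<mu>' \<sigma> c"
proof -
  have less: "lognormal_var \<mu> \<sigma> z < lognormal_var \<mu>' \<sigma> z" for z
    using assms by (simp add: lognormal_var_def)
  obtain a b where ab: "a < b" and below: "\<And>z. z < b \<Longrightarrow> lognormal_var \<mu> \<sigma> z < c"
    using lognormal_var_below[OF assms(1,2)] by metis
  show ?thesis
    unfolding capped_mean_def
  proof (rule std_normal_integral_strict_mono[OF integrable_capped integrable_capped _ ab])
    show "min (lognormal_var \<mu> \<sigma> z) c \<le> min (lognormal_var \<mu>' \<sigma> z) c" for z
      using less[of z] by simp
    show "min (lognormal_var \<mu> \<sigma> z) c < min (lognormal_var \<mu>' \<sigma> z) c" if "z < b" for z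
      using less[of z] below[OF that] by simp
  qed
qed

text \<open>
  The difference of the two exponents is \<open>(\<sigma>' - \<sigma>) (z - (\<sigma> + \<sigma>')/2)\<close>, which gives the single
  crossing.
\<close>

lemma lognormal_var_crossing:
  assumes "\<sigma> < \<sigma>'"
  defines "z\<^sub>0 \<equiv> (\<sigma> + \<sigma>') / 2"
  shows "lognormal_var \<mu> \<sigma>' z < lognormal_var \<mu> \<sigma> z \<longleftrightarrow> z < z\<^sub>0"
    and "lognormal_var \<mu> \<sigma> z < lognormal_var \<mu> \<sigma>' z \<longleftrightarrow> z\<^sub>0 < z"
    and "lognormal_var \<mu> \<sigma> z\<^sub>0 = exp (\<mu> + \<sigma> * \<sigma>' / 2)"
    and "lognormal_var \<mu> \<sigma>' z\<^sub>0 = exp (\<mu> + \<sigma> * \<sigma>' / 2)"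
proof -
  have diff: "(\<mu> - \<sigma>'\<^sup>2 / 2 + \<sigma>' * z) - (\<mu> - \<sigma>\<^sup>2 / 2 + \<sigma> * z) = (\<sigma>' - \<sigma>) * (z - z\<^sub>0)"
    by (simp add: z\<^sub>0_def power2_eq_square field_simps)
  show "lognormal_var \<mu> \<sigma>' z < lognormal_var \<mu> \<sigma> z \<longleftrightarrow> z < z\<^sub>0"
    using diff assms(1) mult_less_0_iff[of "\<sigma>' - \<sigma>" "z - z\<^sub>0"]
    unfolding lognormal_var_def exp_less_cancel_iff by linarith
  show "lognormal_var \<mu> \<sigma> z < lognormal_var \<mu> \<sigma>' z \<longleftrightarrow> z\<^sub>0 < z"
    using diff assms(1) zero_less_mult_iff[of "\<sigma>' - \<sigma>" "z - z\<^sub>0"]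
    unfolding lognormal_var_def exp_less_cancel_iff by linarith
qed (simp_all add: lognormal_var_def z\<^sub>0_def power2_eq_square field_simps)

lemma lognormal_var_mono:
  assumes "0 \<le> \<sigma>" "y \<le> z"
  shows "lognormal_var \<mu> \<sigma> y \<le> lognormal_var \<mu> \<sigma> z"
  using assms by (simp add: lognormal_var_def mult_left_mono)

lemma capped_mean_volatility_less:
  assumes "0 < \<sigma>" "\<sigma> < \<sigma>'" "0 < c"
  shows "capped_mean \<mu> \<sigma>' c < capped_mean \<mu> \<sigma> c"
proof -
  define z\<^sub>0 where "z\<^sub>0 = (\<sigma> + \<sigma>') / 2"
  define y\<^sub>0 where "y\<^sub>0 = exp (\<mu> + \<sigma> * \<sigma>' / 2)"
  let ?b = "lognormal_var \<mu> \<sigma>" and ?b' = "lognormal_var \<mu> \<sigma>'"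
  have "0 < \<sigma>'" using assms by simp
  note mono = lognormal_var_mono[OF less_imp_le, OF \<open>0 < \<sigma>\<close>]
    lognormal_var_mono[OF less_imp_le, OF \<open>0 < \<sigma>'\<close>]
  note crossing = lognormal_var_crossing[OF assms(2), folded z\<^sub>0_def, of \<mu>]
  have before: "?b z \<le> y\<^sub>0" "?b' z \<le> y\<^sub>0" if "z \<le> z\<^sub>0" for z
    using mono[OF that, of \<mu>] crossing(3,4) unfolding y\<^sub>0_def by simp_all
  have after: "y\<^sub>0 \<le> ?b z" "y\<^sub>0 \<le> ?b' z" if "z\<^sub>0 \<le> z" for z
    using mono[OF that, of \<mu>] crossing(3,4) unfolding y\<^sub>0_def by simp_all
  show ?thesis
  proof (cases "c \<le> y\<^sub>0")
    case True
    \<comment> \<open>Strict where the lower curve is still below the cap.\<close>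
    obtain a b where ab: "a < b" "b \<le> z\<^sub>0" and below: "\<And>z. z < b \<Longrightarrow> ?b' z < c"
      using lognormal_var_below[OF \<open>0 < \<sigma>'\<close> \<open>0 < c\<close>] by metis
    show ?thesis
      unfolding capped_mean_def
    proof (rule std_normal_integral_strict_mono[OF integrable_capped integrable_capped _ ab(1)])
      show "min (?b' z) c \<le> min (?b z) c" for z
        using crossing(1)[of z] after[of z] True by (cases "z < z\<^sub>0") auto
      show "min (?b' z) c < min (?b z) c" if "z < b" for z
        using crossing(1)[of z] below[OF that] that ab(2) by auto
    qed
  next
    case False
    \<comment> \<open>Compare the excess over the cap; strict where the higher curve exceeds the cap.\<close>
    obtain a b where ab: "a < b" "z\<^sub>0 \<le> a" and above: "\<And>z. a < z \<Longrightarrow> c < ?b' z"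
      using lognormal_var_above[OF \<open>0 < \<sigma>'\<close>] by metis
    have "(\<integral>z. ?b z - min (?b z) c \<partial>std_normal) < (\<integral>z. ?b' z - min (?b' z) c \<partial>std_normal)"
    proof (rule std_normal_integral_strict_mono[OF _ _ _ ab(1)])
      show "?b z - min (?b z) c \<le> ?b' z - min (?b' z) c" for z
        using crossing(2)[of z] before[of z] False by (cases "z\<^sub>0 < z") auto
      show "?b z - min (?b z) c < ?b' z - min (?b' z) c" if "a < z" for z
        using crossing(2)[of z] above[OF that] that ab(2) by auto
    qed (intro Bochner_Integration.integrable_diff integrable_lognormal_var integrable_capped)+
    then show ?thesis
      by (simp add: Bochner_Integration.integral_diff integrable_lognormal_var integrable_capped
          mean_lognormal_var capped_mean_def)
  qed
qed

section \<open>The censor as the unique root\<close>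

lemma capped_mean_le_cap: "capped_mean \<mu> \<sigma> c \<le> c"
proof -
  have "capped_mean \<mu> \<sigma> c \<le> (\<integral>z. c \<partial>std_normal)"
    unfolding capped_mean_def by (intro integral_mono integrable_capped) simp_all
  then show ?thesis using std_normal.prob_space by simp
qed

lemma capped_mean_lipschitz: "\<bar>capped_mean \<mu> \<sigma> c - capped_mean \<mu> \<sigma> d\<bar> \<le> \<bar>c - d\<bar>"
proof -
  let ?f = "\<lambda>c z. min (lognormal_var \<mu> \<sigma> z) c"
  have "\<bar>capped_mean \<mu> \<sigma> c - capped_mean \<mu> \<sigma> d\<bar> = \<bar>\<integral>z. ?f c z - ?f d z \<partial>std_normal\<bar>"
    by (simp add: capped_mean_def Bochner_Integration.integral_diff integrable_capped)
  also have "\<dots> \<le> (\<integral>z. \<bar>?f c z - ?f d z\<bar> \<partial>std_normal)"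
    by (rule integral_abs_bound)
  also have "\<dots> \<le> (\<integral>z. \<bar>c - d\<bar> \<partial>std_normal)"
  proof (rule integral_mono)
    show "integrable std_normal (\<lambda>z. \<bar>?f c z - ?f d z\<bar>)"
      by (intro Bochner_Integration.integrable_abs
          Bochner_Integration.integrable_diff[OF integrable_capped integrable_capped])
    show "\<bar>?f c z - ?f d z\<bar> \<le> \<bar>c - d\<bar>" for z
      by linarith
  qed simp
  also have "\<dots> = \<bar>c - d\<bar>"
    using std_normal.prob_space by simp
  finally show ?thesis .
qed

lemma continuous_on_capped_mean: "continuous_on A (capped_mean \<mu> \<sigma>)"
proof (rule lipschitz_on_continuous_on)
  show "1-lipschitz_on A (capped_mean \<mu> \<sigma>)"
    by (rule lipschitz_onI) (simp_all add: dist_real_def capped_mean_lipschitz)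
qed

lemma capped_mean_tendsto_mean: "(\<lambda>n. capped_mean \<mu> \<sigma> (real n)) \<longlonglongrightarrow> exp \<mu>"
proof -
  let ?b = "lognormal_var \<mu> \<sigma>"
  have "(\<lambda>n. \<integral>z. min (?b z) (real n) \<partial>std_normal) \<longlonglongrightarrow> (\<integral>z. ?b z \<partial>std_normal)"
  proof (rule integral_dominated_convergence[where w = ?b and s = "\<lambda>n z. min (?b z) (real n)"
        and f = ?b and M = std_normal])
    have "(\<lambda>n. min (?b z) (real n)) \<longlonglongrightarrow> ?b z" for z
    proof (rule tendsto_eventually)
      show "\<forall>\<^sub>F n in sequentially. min (?b z) (real n) = ?b z"
        using eventually_ge_at_top[of "nat \<lceil>?b z\<rceil>"]
        by eventually_elim (simp add: nat_ceiling_le_eq)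
    qed
    then show "AE z in std_normal. (\<lambda>n. min (?b z) (real n)) \<longlonglongrightarrow> ?b z"
      by simp
    have "norm (min (?b z) (real n)) \<le> ?b z" for n z
      using lognormal_var_pos[of \<mu> \<sigma> z] by (auto simp: min_def)
    then show "AE z in std_normal. norm (min (?b z) (real n)) \<le> ?b z" for n
      by simp
  qed (simp_all add: integrable_lognormal_var)
  then show ?thesis
    by (simp add: capped_mean_def mean_lognormal_var)
qed

text \<open>
  A positive drift is what makes the equation solvable: the capped mean is at most 1 at the cap 1
  and tends to \<open>exp \<mu> > 1\<close> as the cap grows.
\<close>

lemma capped_mean_eq_1_iff:
  assumes "0 < \<mu>" "0 < \<sigma>"
  shows "capped_mean \<mu> \<sigma> c = 1 \<longleftrightarrow> c = censor \<mu> \<sigma>"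
proof -
  have "\<forall>\<^sub>F n in sequentially. 1 < capped_mean \<mu> \<sigma> (real n)"
    using assms(1) by (intro order_tendstoD(1)[OF capped_mean_tendsto_mean]) simp
  then obtain n where n: "1 < capped_mean \<mu> \<sigma> (real n)"
    by (auto simp: eventually_sequentially)
  moreover have "1 \<le> real n"
    using n capped_mean_le_cap[of \<mu> \<sigma> "real n"] by linarith
  ultimately obtain r where r: "capped_mean \<mu> \<sigma> r = 1"
    using IVT'[of "capped_mean \<mu> \<sigma>" 1 1 "real n"] capped_mean_le_cap[of \<mu> \<sigma> 1]
      continuous_on_capped_mean by force
  have unique: "capped_mean \<mu> \<sigma> d = 1 \<longleftrightarrow> d = r" for d
    using strict_mono_eq[OF capped_mean_cap_strict_mono[OF assms(2), of \<mu>], of d r] r by simp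
  then show ?thesis
    by (simp add: censor_eq_root_capped_mean[OF assms(2)])
qed

lemma capped_mean_censor:
  assumes "0 < \<mu>" "0 < \<sigma>"
  shows "capped_mean \<mu> \<sigma> (censor \<mu> \<sigma>) = 1"
  using capped_mean_eq_1_iff[OF assms] by simp

lemma censor_pos:
  assumes "0 < \<mu>" "0 < \<sigma>"
  shows "0 < censor \<mu> \<sigma>"
  using capped_mean_le_cap[of \<mu> \<sigma> "censor \<mu> \<sigma>"] capped_mean_censor[OF assms] by simp

section \<open>Monotonicity of the censor\<close>

text \<open>
  Both monotonicity claims come down to this comparison, with \<open>c\<close> the censor of the other
  parameter pair.
\<close>

lemma censor_less_if_capped_mean_gt:
  assumes "0 < \<mu>'" "0 < \<sigma>'" "1 < capped_mean \<mu>' \<sigma>' c"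
  shows "censor \<mu>' \<sigma>' < c"
  using assms capped_mean_censor[OF assms(1,2)]
    strict_mono_less[OF capped_mean_cap_strict_mono[OF assms(2)]] by metis

theorem theorem5:
  shows "(\<forall>\<sigma>>0. strict_antimono_on {0<..} (\<lambda>\<mu>. censor \<mu> \<sigma>)) \<and>
         (\<forall>\<mu>>0. strict_mono_on {0<..} (\<lambda>\<sigma>. censor \<mu> \<sigma>))"
proof (intro conjI allI impI)
  fix \<sigma> :: real assume "0 < \<sigma>"
  show "strict_antimono_on {0<..} (\<lambda>\<mu>. censor \<mu> \<sigma>)"
  proof (rule monotone_onI)
    fix \<mu> \<mu>' :: real assume "\<mu> \<in> {0<..}" "\<mu>' \<in> {0<..}" "\<mu> < \<mu>'"
    then show "censor \<mu>' \<sigma> < censor \<mu> \<sigma>"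
      using \<open>0 < \<sigma>\<close> capped_mean_drift_less[of \<sigma> "censor \<mu> \<sigma>" \<mu> \<mu>']
      by (intro censor_less_if_capped_mean_gt) (simp_all add: capped_mean_censor censor_pos)
  qed
next
  fix \<mu> :: real assume "0 < \<mu>"
  show "strict_mono_on {0<..} (\<lambda>\<sigma>. censor \<mu> \<sigma>)"
  proof (rule monotone_onI)
    fix \<sigma> \<sigma>' :: real assume "\<sigma> \<in> {0<..}" "\<sigma>' \<in> {0<..}" "\<sigma> < \<sigma>'"
    then show "censor \<mu> \<sigma> < censor \<mu> \<sigma>'"
      using \<open>0 < \<mu>\<close> capped_mean_volatility_less[of \<sigma> \<sigma>' "censor \<mu> \<sigma>'" \<mu>]
      by (intro censor_less_if_capped_mean_gt) (simp_all add: capped_mean_censor censor_pos)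
  qed
qed

end
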